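(* Let $A$ be an LM$_\theta$-algebra. The lattice $\mathcal{CO}_M(X(A))$ of all closed, open and modal subsets of $X(A)$ is isomorphic to the lattice $Con_{bLM_\theta}(A)$ of Boolean congruences of $A$ via $G\mapsto\{(a,b)\in A\times A:\sigma_A(b)\triangle\sigma_A(a)\subseteq G\}$, and is isomorphic to the dual of $Con_{bLM_\theta}(A)$ via $Y\mapsto\{(a,b)\in A\times A:\sigma_A(a)\cap Y=\sigma_A(b)\cap Y\}$.
   Context: Let $\theta\ge 2$ be the order type of a totally ordered set $J$ with least element $0$, $J=\{0\}+I$ (ordinal sum). An LM$_\theta$-algebra is an algebra $\langle A,\vee,\wedge,0,1,\{\phi_i\}_{i\in I},\{\overline{\phi}_i\}_{i\in I}\rangle$ with $\langle A,\vee,\wedge,0,1\rangle$ a bounded distributive lattice such that for all $i,j\in I$, $x,y\in A$: $\phi_i$ is a bounded lattice endomorphism; $\phi_i x\vee\overline{\phi}_i x=1$, $\phi_i x\wedge\overline{\phi}_i x=0$; $\phi_i\phi_j x=\phi_j x$; $i\le j$ implies $\phi_i x\le\phi_j x$; $\phi_i x=\phi_i y$ for all $i$ implies $x=y$. A Boolean congruence of $A$ is a congruence that has a complement in the lattice of all congruences of $A$. $X(A)$ is the set of prime filters of $A$ ordered by inclusion, with subbasis $\sigma_A(a)=\{P:a\in P\}$, $X(A)\setminus\sigma_A(a)$; $f_i^A(P)=\phi_i^{-1}(P)$. $Y\subseteq X(A)$ is modal if $Y=(f_i^A)^{-1}(Y)$ for all $i\in I$. *)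

theory Defs
  imports "HOL-Algebra.Lattice" "HOL-Analysis.Abstract_Topology"
begin

text \<open>
  The chain \<open>J = {0} + I\<close> is a type of class \<open>{linorder, order_bot}\<close> whose least element is \<open>0\<close>, so
  that \<open>I\<close> is \<open>{bot<..}\<close>. Here \<open>\<phi>b\<close> is $\overline{\phi}$; the values of \<open>\<phi>\<close> and \<open>\<phi>b\<close> at the index
  \<open>bot\<close> are irrelevant throughout. Type class operations are written with qualified names,
  since HOL-Algebra uses the same base names for lattices with an explicit carrier.
\<close>

locale LM_algebra =
  fixes \<phi> \<phi>b :: "'j::{linorder,order_bot} \<Rightarrow> 'a::{distrib_lattice,bounded_lattice} \<Rightarrow> 'a"
  assumes index_nonempty: "{Orderings.bot<..} \<noteq> ({} :: 'j set)"
    and phi_sup: "i > Orderings.bot \<Longrightarrow> \<phi> i (Lattices.sup x y) = Lattices.sup (\<phi> i x) (\<phi> i y)"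
    and phi_inf: "i > Orderings.bot \<Longrightarrow> \<phi> i (Lattices.inf x y) = Lattices.inf (\<phi> i x) (\<phi> i y)"
    and phi_bot: "i > Orderings.bot \<Longrightarrow> \<phi> i Orderings.bot = Orderings.bot"
    and phi_top: "i > Orderings.bot \<Longrightarrow> \<phi> i Orderings.top = Orderings.top"
    and phi_sup_compl: "i > Orderings.bot \<Longrightarrow> Lattices.sup (\<phi> i x) (\<phi>b i x) = Orderings.top"
    and phi_inf_compl: "i > Orderings.bot \<Longrightarrow> Lattices.inf (\<phi> i x) (\<phi>b i x) = Orderings.bot"
    and phi_phi: "\<lbrakk>i > Orderings.bot; j > Orderings.bot\<rbrakk> \<Longrightarrow> \<phi> i (\<phi> j x) = \<phi> j x"
    and phi_mono: "\<lbrakk>i > Orderings.bot; j > Orderings.bot; i \<le> j\<rbrakk> \<Longrightarrow> \<phi> i x \<le> \<phi> j x"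
    and phi_determination: "(\<And>i. i > Orderings.bot \<Longrightarrow> \<phi> i x = \<phi> i y) \<Longrightarrow> x = y"

subsection \<open>Congruences\<close>

definition LM_congruence ::
  "('j::{linorder,order_bot} \<Rightarrow> 'a::{distrib_lattice,bounded_lattice} \<Rightarrow> 'a) \<Rightarrow> ('j \<Rightarrow> 'a \<Rightarrow> 'a) \<Rightarrow> 'a rel \<Rightarrow> bool"
  where "LM_congruence \<phi> \<phi>b R \<longleftrightarrow>
    equiv UNIV R \<and>
    (\<forall>a b c d. (a, b) \<in> R \<longrightarrow> (c, d) \<in> R \<longrightarrow> (Lattices.sup a c, Lattices.sup b d) \<in> R) \<and>
    (\<forall>a b c d. (a, b) \<in> R \<longrightarrow> (c, d) \<in> R \<longrightarrow> (Lattices.inf a c, Lattices.inf b d) \<in> R) \<and>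
    (\<forall>i>Orderings.bot. \<forall>a b. (a, b) \<in> R \<longrightarrow> (\<phi> i a, \<phi> i b) \<in> R) \<and>
    (\<forall>i>Orderings.bot. \<forall>a b. (a, b) \<in> R \<longrightarrow> (\<phi>b i a, \<phi>b i b) \<in> R)"

definition inclusion_order :: "'b set set \<Rightarrow> 'b set gorder"
  where "inclusion_order C = \<lparr>carrier = C, eq = (=), le = (\<subseteq>)\<rparr>"

definition Con_LM ::
  "('j::{linorder,order_bot} \<Rightarrow> 'a::{distrib_lattice,bounded_lattice} \<Rightarrow> 'a) \<Rightarrow> ('j \<Rightarrow> 'a \<Rightarrow> 'a) \<Rightarrow> 'a rel gorder"
  where "Con_LM \<phi> \<phi>b = inclusion_order {R. LM_congruence \<phi> \<phi>b R}"

definition complement_in :: "('b, 'c) gorder_scheme \<Rightarrow> 'b \<Rightarrow> 'b \<Rightarrow> bool"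
  where "complement_in L x y \<longleftrightarrow> x \<in> carrier L \<and> y \<in> carrier L \<and>
    x \<squnion>\<^bsub>L\<^esub> y = \<top>\<^bsub>L\<^esub> \<and> x \<sqinter>\<^bsub>L\<^esub> y = \<bottom>\<^bsub>L\<^esub>"

definition Con_bLM ::
  "('j::{linorder,order_bot} \<Rightarrow> 'a::{distrib_lattice,bounded_lattice} \<Rightarrow> 'a) \<Rightarrow> ('j \<Rightarrow> 'a \<Rightarrow> 'a) \<Rightarrow> 'a rel gorder"
  where "Con_bLM \<phi> \<phi>b = inclusion_order {R. \<exists>S. complement_in (Con_LM \<phi> \<phi>b) R S}"

subsection \<open>The space of prime filters\<close>

definition prime_filter :: "'a::{distrib_lattice,bounded_lattice} set \<Rightarrow> bool"
  where "prime_filter P \<longleftrightarrow>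
    P \<noteq> {} \<and> P \<noteq> UNIV \<and>
    (\<forall>x\<in>P. \<forall>y. x \<le> y \<longrightarrow> y \<in> P) \<and>
    (\<forall>x\<in>P. \<forall>y\<in>P. Lattices.inf x y \<in> P) \<and>
    (\<forall>x y. Lattices.sup x y \<in> P \<longrightarrow> x \<in> P \<or> y \<in> P)"

definition prime_filters :: "'a::{distrib_lattice,bounded_lattice} set set"
  where "prime_filters = {P. prime_filter P}"

definition \<sigma> :: "'a::{distrib_lattice,bounded_lattice} \<Rightarrow> 'a set set"
  where "\<sigma> a = {P \<in> prime_filters. a \<in> P}"

definition prime_filter_space :: "'a::{distrib_lattice,bounded_lattice} set topology"
  where "prime_filter_space = topology_generated_by (range \<sigma> \<union> range (\<lambda>a. prime_filters - \<sigma> a))"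

lemma topspace_prime_filter_space: "topspace prime_filter_space = prime_filters"
  unfolding prime_filter_space_def topology_generated_by_topspace by (auto simp: \<sigma>_def)

definition modal ::
  "('j::{linorder,order_bot} \<Rightarrow> 'a::{distrib_lattice,bounded_lattice} \<Rightarrow> 'a) \<Rightarrow> 'a set set \<Rightarrow> bool"
  where "modal \<phi> Y \<longleftrightarrow> Y \<subseteq> prime_filters \<and>
    (\<forall>i>Orderings.bot. Y = {P \<in> prime_filters. \<phi> i -` P \<in> Y})"

definition CO_M ::
  "('j::{linorder,order_bot} \<Rightarrow> 'a::{distrib_lattice,bounded_lattice} \<Rightarrow> 'a) \<Rightarrow> 'a set set gorder"
  where "CO_M \<phi> = inclusion_order
    {Y. closedin prime_filter_space Y \<and> openin prime_filter_space Y \<and> modal \<phi> Y}"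

subsection \<open>Lattice isomorphisms\<close>

text \<open>The predicates \<^const>\<open>join_pres\<close> and \<^const>\<open>meet_pres\<close> include the requirement
  that both structures are lattices.\<close>

definition lattice_iso :: "('b, 'd) gorder_scheme \<Rightarrow> ('c, 'e) gorder_scheme \<Rightarrow> ('b \<Rightarrow> 'c) \<Rightarrow> bool"
  where "lattice_iso L M f \<longleftrightarrow>
    bij_betw f (carrier L) (carrier M) \<and> join_pres L M f \<and> meet_pres L M f"

end

theory Submission
  imports Defs
begin

text \<open>
  As in Priestley duality, a congruence \<open>R\<close> corresponds to the set of prime filters saturated
  under \<open>R\<close>, and a closed set \<open>Y\<close> of prime filters to the congruence of agreement on \<open>Y\<close>; being
  compatible with the \<open>\<phi> i\<close> means that \<open>\<phi> i -` P \<in> Y\<close> whenever \<open>P \<in> Y\<close>. If \<open>R\<close> and \<open>S\<close> are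
  complementary congruences then their sets of saturated prime filters are disjoint, because
  \<open>R\<close> and \<open>S\<close> are both contained in the agreement on the intersection, and they cover the space,
  because \<open>R\<close> and \<open>S\<close> intersect in the identity. So both are clopen, and two complementary sets
  stable under the inverse images of all \<open>\<phi> i\<close> are modal. All separation comes from the prime
  filter theorem modulo a congruence; compactness of the space is not needed.
\<close>

subsection \<open>Lattices of sets ordered by inclusion\<close>

lemma partial_order_inclusion_order: "partial_order (inclusion_order C)"
  by unfold_locales (auto simp: inclusion_order_def)

lemma partial_order_inv_gorder:
  assumes "partial_order L"
  shows "partial_order (inv_gorder L)"
proof -
  interpret L: partial_order L by fact
  interpret weak_partial_order "inv_gorder L" by (rule L.dual_weak_order)
  show ?thesis
    by unfold_locales (simp add: L.eq_is_equal)
qed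

lemma join_eqI:
  assumes "partial_order L" "least L s (Upper L {x, y})"
  shows "x \<squnion>\<^bsub>L\<^esub> y = s"
proof -
  interpret partial_order L by fact
  show ?thesis
    unfolding join_def sup_def using assms(2) least_unique by (blast intro: some_equality)
qed

lemma meet_eqI:
  assumes "partial_order L" "greatest L s (Lower L {x, y})"
  shows "x \<sqinter>\<^bsub>L\<^esub> y = s"
proof -
  interpret partial_order L by fact
  show ?thesis
    unfolding meet_def inf_def using assms(2) greatest_unique by (blast intro: some_equality)
qed

lemma least_Upper_pair_iff:
  assumes "x \<in> carrier L" "y \<in> carrier L"
  shows "least L s (Upper L {x, y}) \<longleftrightarrow>
    s \<in> carrier L \<and> x \<sqsubseteq>\<^bsub>L\<^esub> s \<and> y \<sqsubseteq>\<^bsub>L\<^esub> s \<and> (\<forall>u\<in>carrier L. x \<sqsubseteq>\<^bsub>L\<^esub> u \<longrightarrow> y \<sqsubseteq>\<^bsub>L\<^esub> u \<longrightarrow> s \<sqsubseteq>\<^bsub>L\<^esub> u)"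
  using assms by (auto simp: least_def Upper_def)

lemma greatest_Lower_pair_iff:
  assumes "x \<in> carrier L" "y \<in> carrier L"
  shows "greatest L s (Lower L {x, y}) \<longleftrightarrow>
    s \<in> carrier L \<and> s \<sqsubseteq>\<^bsub>L\<^esub> x \<and> s \<sqsubseteq>\<^bsub>L\<^esub> y \<and> (\<forall>u\<in>carrier L. u \<sqsubseteq>\<^bsub>L\<^esub> x \<longrightarrow> u \<sqsubseteq>\<^bsub>L\<^esub> y \<longrightarrow> u \<sqsubseteq>\<^bsub>L\<^esub> s)"
  using assms by (auto simp: greatest_def Lower_def)

lemma lattice_inclusion_orderI:
  assumes "\<And>x y. x \<in> C \<Longrightarrow> y \<in> C \<Longrightarrow> x \<union> y \<in> C"
    and "\<And>x y. x \<in> C \<Longrightarrow> y \<in> C \<Longrightarrow> x \<inter> y \<in> C"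
  shows "lattice (inclusion_order C)"
proof -
  interpret partial_order "inclusion_order C" by (rule partial_order_inclusion_order)
  show ?thesis
  proof
    fix x y
    assume xy: "x \<in> carrier (inclusion_order C)" "y \<in> carrier (inclusion_order C)"
    show "\<exists>s. least (inclusion_order C) s (Upper (inclusion_order C) {x, y})"
      using xy assms(1) by (intro exI[of _ "x \<union> y"])
        (simp add: least_Upper_pair_iff, simp add: inclusion_order_def)
    show "\<exists>s. greatest (inclusion_order C) s (Lower (inclusion_order C) {x, y})"
      using xy assms(2) by (intro exI[of _ "x \<inter> y"])
        (simp add: greatest_Lower_pair_iff, simp add: inclusion_order_def)
  qed
qed

text \<open>An order isomorphism transports least upper and greatest lower bounds, so
  \<open>M\<close> becomes a lattice along the way. Joins and meets of Boolean congruences then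
  never have to be computed; comparing inclusions suffices.\<close>

lemma lattice_iso_of_order_iso:
  assumes L: "lattice L" and M: "partial_order M"
    and bij: "bij_betw f (carrier L) (carrier M)"
    and le: "\<And>x y. x \<in> carrier L \<Longrightarrow> y \<in> carrier L \<Longrightarrow> f x \<sqsubseteq>\<^bsub>M\<^esub> f y \<longleftrightarrow> x \<sqsubseteq>\<^bsub>L\<^esub> y"
  shows "lattice_iso L M f"
proof -
  interpret L: lattice L by fact
  interpret M: partial_order M by fact
  have carrier_M: "carrier M = f ` carrier L"
    using bij by (simp add: bij_betw_def)
  have least: "least M (f s) (Upper M {f x, f y})"
    if "x \<in> carrier L" "y \<in> carrier L" "least L s (Upper L {x, y})" for x y s
    using that by (simp add: least_Upper_pair_iff carrier_M le)
  have greatest: "greatest M (f s) (Lower M {f x, f y})"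
    if "x \<in> carrier L" "y \<in> carrier L" "greatest L s (Lower L {x, y})" for x y s
    using that by (simp add: greatest_Lower_pair_iff carrier_M le)
  have "lattice M"
  proof
    fix x y
    assume "x \<in> carrier M" "y \<in> carrier M"
    then obtain a b where "a \<in> carrier L" "b \<in> carrier L" "x = f a" "y = f b"
      by (auto simp: carrier_M)
    then show "\<exists>s. least M s (Upper M {x, y})" "\<exists>s. greatest M s (Lower M {x, y})"
      using least greatest L.sup_of_two_exists L.inf_of_two_exists by blast+
  qed
  moreover have "f (x \<squnion>\<^bsub>L\<^esub> y) = f x \<squnion>\<^bsub>M\<^esub> f y \<and> f (x \<sqinter>\<^bsub>L\<^esub> y) = f x \<sqinter>\<^bsub>M\<^esub> f y"
    if xy: "x \<in> carrier L" "y \<in> carrier L" for x y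
  proof -
    obtain s t where "least L s (Upper L {x, y})" "greatest L t (Lower L {x, y})"
      using L.sup_of_two_exists[OF xy] L.inf_of_two_exists[OF xy] by blast
    then show ?thesis
      using join_eqI[OF M least[OF xy]] meet_eqI[OF M greatest[OF xy]]
      by (simp add: join_eqI[OF L.partial_order_axioms] meet_eqI[OF L.partial_order_axioms])
  qed
  ultimately show ?thesis
    using bij L by (simp add: lattice_iso_def join_pres_def meet_pres_def)
qed

subsection \<open>Prime filters modulo a congruence\<close>

lemma prime_filterD:
  assumes "prime_filter P"
  shows "Orderings.top \<in> P" "Orderings.bot \<notin> P"
    "Lattices.inf x y \<in> P \<longleftrightarrow> x \<in> P \<and> y \<in> P"
    "Lattices.sup x y \<in> P \<longleftrightarrow> x \<in> P \<or> y \<in> P"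
proof -
  have up: "x \<in> P \<Longrightarrow> x \<le> y \<Longrightarrow> y \<in> P" for x y
    using assms by (auto simp: prime_filter_def)
  obtain p q where "p \<in> P" "q \<notin> P"
    using assms by (auto simp: prime_filter_def)
  then show "Orderings.top \<in> P" "Orderings.bot \<notin> P"
    using up[of p Orderings.top] up[of Orderings.bot q] by auto
  have "Lattices.inf x y \<in> P" if "x \<in> P" "y \<in> P"
    using that assms unfolding prime_filter_def by blast
  then show "Lattices.inf x y \<in> P \<longleftrightarrow> x \<in> P \<and> y \<in> P"
    using up[of "Lattices.inf x y" x] up[of "Lattices.inf x y" y] by auto
  have "x \<in> P \<or> y \<in> P" if "Lattices.sup x y \<in> P"
    using that assms unfolding prime_filter_def by blast
  then show "Lattices.sup x y \<in> P \<longleftrightarrow> x \<in> P \<or> y \<in> P"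
    using up[of x "Lattices.sup x y"] up[of y "Lattices.sup x y"] by auto
qed

text \<open>The prime filter theorem for a preorder \<open>le\<close> coarser than the lattice
  order: by Zorn, take a filter maximal among those closed under \<open>le\<close>, containing
  \<open>a\<close> and avoiding \<open>b\<close>. With the preorder of a quotient lattice it yields
  prime filters of the quotient without constructing it.\<close>

lemma prime_filter_for_preorder:
  fixes le :: "'a::{distrib_lattice,bounded_lattice} \<Rightarrow> 'a \<Rightarrow> bool"
  assumes le: "\<And>x y. x \<le> y \<Longrightarrow> le x y"
    and trans: "\<And>x y z. le x y \<Longrightarrow> le y z \<Longrightarrow> le x z"
    and inf: "\<And>x y z. le z x \<Longrightarrow> le z y \<Longrightarrow> le z (Lattices.inf x y)"
    and sup: "\<And>x y z. le x z \<Longrightarrow> le y z \<Longrightarrow> le (Lattices.sup x y) z"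
    and ab: "\<not> le a b"
  shows "\<exists>P. prime_filter P \<and> (\<forall>x y. le x y \<longrightarrow> x \<in> P \<longrightarrow> y \<in> P) \<and> a \<in> P \<and> b \<notin> P"
proof -
  define good where "good F \<longleftrightarrow> a \<in> F \<and> b \<notin> F \<and> (\<forall>x y. x \<in> F \<longrightarrow> le x y \<longrightarrow> y \<in> F) \<and>
    (\<forall>x y. x \<in> F \<longrightarrow> y \<in> F \<longrightarrow> Lattices.inf x y \<in> F)" for F
  have goodI: "good F" if "a \<in> F" "b \<notin> F" "\<And>x y. x \<in> F \<Longrightarrow> le x y \<Longrightarrow> y \<in> F"
    "\<And>x y. x \<in> F \<Longrightarrow> y \<in> F \<Longrightarrow> Lattices.inf x y \<in> F" for F
    using that by (simp add: good_def)
  have goodD: "a \<in> F" "b \<notin> F" "\<And>x y. x \<in> F \<Longrightarrow> le x y \<Longrightarrow> y \<in> F"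
    "\<And>x y. x \<in> F \<Longrightarrow> y \<in> F \<Longrightarrow> Lattices.inf x y \<in> F" if "good F" for F
    using that unfolding good_def by blast+
  \<comment> \<open>The principal filter of \<open>a\<close> makes the family for Zorn's lemma
    nonempty; \<open>ab\<close> keeps \<open>b\<close> out of it.\<close>
  have "good {x. le a x}"
    by (rule goodI; unfold mem_Collect_eq) (simp add: le, rule ab, erule (1) trans, erule (1) inf)
  moreover have "good (\<Union>\<C>)" if "\<C> \<noteq> {}" "subset.chain (Collect good) \<C>" for \<C>
  proof (rule goodI)
    have \<C>: "\<And>X. X \<in> \<C> \<Longrightarrow> good X" and chain: "\<And>X Y. X \<in> \<C> \<Longrightarrow> Y \<in> \<C> \<Longrightarrow> X \<subseteq> Y \<or> Y \<subseteq> X"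
      using that(2) by (auto simp: subset_chain_def)
    show "a \<in> \<Union>\<C>" "b \<notin> \<Union>\<C>"
      using that(1) goodD(1,2)[OF \<C>] by blast+
    show "y \<in> \<Union>\<C>" if "x \<in> \<Union>\<C>" "le x y" for x y
      using that goodD(3)[OF \<C>] by blast
    show "Lattices.inf x y \<in> \<Union>\<C>" if "x \<in> \<Union>\<C>" "y \<in> \<Union>\<C>" for x y
    proof -
      obtain X Y where XY: "X \<in> \<C>" "Y \<in> \<C>" "x \<in> X" "y \<in> Y"
        using \<open>x \<in> \<Union>\<C>\<close> \<open>y \<in> \<Union>\<C>\<close> by blast
      then obtain Z where "Z \<in> \<C>" "x \<in> Z" "y \<in> Z"
        using chain[of X Y] by blast
      then show ?thesis
        using goodD(4)[OF \<C>] by blast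
    qed
  qed
  ultimately obtain P where "good P" and max: "\<And>X. good X \<Longrightarrow> P \<subseteq> X \<Longrightarrow> X = P"
    using subset_Zorn_nonempty[of "Collect good"] by auto
  note P = goodD[OF \<open>good P\<close>]
  \<comment> \<open>Both inequalities survive when the filter element is shrunk to
    \<open>inf f g\<close>, so two elements of a filter can be replaced by a common one.\<close>
  have restrict1: "le (Lattices.inf (Lattices.inf f g) x) y" if "le (Lattices.inf f x) y" for f g x y
    by (rule trans[OF le that]) (rule inf_mono; simp)
  have restrict2: "le (Lattices.inf (Lattices.inf f g) x) y" if "le (Lattices.inf g x) y" for f g x y
    by (rule trans[OF le that]) (rule inf_mono; simp)
  \<comment> \<open>By maximality: the closure under \<open>le\<close> of all \<open>inf f x\<close>
    with \<open>f\<close> in \<open>P\<close> is a filter containing \<open>P\<close> and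
    \<open>x\<close>, so it must contain \<open>b\<close>.\<close>
  have ext: "\<exists>f\<in>P. le (Lattices.inf f x) b" if "x \<notin> P" for x
  proof (rule ccontr)
    assume no: "\<not> ?thesis"
    let ?X = "{z. \<exists>f\<in>P. le (Lattices.inf f x) z}"
    have "P \<subseteq> ?X"
      using le[OF inf_le1] by blast
    moreover have "Lattices.inf y z \<in> ?X" if yz: "y \<in> ?X" "z \<in> ?X" for y z
    proof -
      from yz obtain f g where fg: "f \<in> P" "g \<in> P"
        "le (Lattices.inf f x) y" "le (Lattices.inf g x) z"
        by blast
      have "le (Lattices.inf (Lattices.inf f g) x) y"
        "le (Lattices.inf (Lattices.inf f g) x) z"
        using restrict1[OF fg(3)] restrict2[OF fg(4)] .
      then show ?thesis
        using inf P(4)[OF fg(1,2)] by blast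
    qed
    moreover have "z \<in> ?X" if y: "y \<in> ?X" "le y z" for y z
      using y trans[OF _ y(2)] by blast
    ultimately have "good ?X"
      using no P(1) by (intro goodI) auto
    then have "?X = P"
      using max \<open>P \<subseteq> ?X\<close> by simp
    moreover have "x \<in> ?X"
      using P(1) le[OF inf_le2] by blast
    ultimately show False
      using that by blast
  qed
  have "x \<in> P \<or> y \<in> P" if xy: "Lattices.sup x y \<in> P" for x y
  proof (rule ccontr)
    assume "\<not> ?thesis"
    then obtain f g where fg: "f \<in> P" "g \<in> P"
      "le (Lattices.inf f x) b" "le (Lattices.inf g y) b"
      using ext by blast
    let ?h = "Lattices.inf f g"
    have "le (Lattices.inf ?h x) b" "le (Lattices.inf ?h y) b"
      using restrict1[OF fg(3)] restrict2[OF fg(4)] .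
    \<comment> \<open>Distributivity splits the meet with the join, so \<open>b\<close> lies above
      an element of \<open>P\<close>.\<close>
    then have "le (Lattices.inf ?h (Lattices.sup x y)) b"
      using sup by (simp add: inf_sup_distrib1)
    then show False
      using P(2) P(3)[OF P(4)[OF P(4)[OF fg(1,2)] xy]] by blast
  qed
  then have "prime_filter P"
    unfolding prime_filter_def using P le by auto
  then show ?thesis
    using P(1-3) by blast
qed

section \<open>Passing between relations on the algebra and sets of prime filters\<close>

text \<open>For a lattice congruence \<open>R\<close> these are the inverse images of the prime
  filters of the quotient by \<open>R\<close>. The definition makes sense for any relation and is
  also applied to unions of congruences.\<close>

definition saturated_primes :: "'a::{distrib_lattice,bounded_lattice} rel \<Rightarrow> 'a set set"
  where "saturated_primes R = {P \<in> prime_filters. \<forall>(a, b)\<in>R. a \<in> P \<longleftrightarrow> b \<in> P}"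

definition agreement :: "'a::{distrib_lattice,bounded_lattice} set set \<Rightarrow> 'a rel"
  where "agreement Y = {(a, b). \<sigma> a \<inter> Y = \<sigma> b \<inter> Y}"

lemma mem_agreement_iff:
  assumes "Y \<subseteq> prime_filters"
  shows "(a, b) \<in> agreement Y \<longleftrightarrow> (\<forall>P\<in>Y. a \<in> P \<longleftrightarrow> b \<in> P)"
  using assms by (auto simp: agreement_def \<sigma>_def)

lemma LM_congruenceD:
  assumes "LM_congruence \<phi> \<phi>b R"
  shows "(a, a) \<in> R" "(a, b) \<in> R \<Longrightarrow> (b, a) \<in> R" "(a, b) \<in> R \<Longrightarrow> (b, c) \<in> R \<Longrightarrow> (a, c) \<in> R"
    "(a, b) \<in> R \<Longrightarrow> (c, d) \<in> R \<Longrightarrow> (Lattices.sup a c, Lattices.sup b d) \<in> R"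
    "(a, b) \<in> R \<Longrightarrow> (c, d) \<in> R \<Longrightarrow> (Lattices.inf a c, Lattices.inf b d) \<in> R"
    "i > Orderings.bot \<Longrightarrow> (a, b) \<in> R \<Longrightarrow> (\<phi> i a, \<phi> i b) \<in> R"
    "i > Orderings.bot \<Longrightarrow> (a, b) \<in> R \<Longrightarrow> (\<phi>b i a, \<phi>b i b) \<in> R"
  using assms by (auto simp: LM_congruence_def equiv_def refl_on_def dest: symD transD)

text \<open>The hypothesis says that the class of \<open>a\<close> is not below the class of
  \<open>b\<close> in the quotient by \<open>R\<close>, so the prime filter theorem applies
  there.\<close>

lemma congruence_prime_separation:
  fixes \<phi> \<phi>b :: "'j::{linorder,order_bot} \<Rightarrow> 'a::{distrib_lattice,bounded_lattice} \<Rightarrow> 'a"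
  assumes R: "LM_congruence \<phi> \<phi>b R" and ab: "(Lattices.inf a b, a) \<notin> R"
  obtains P where "P \<in> saturated_primes R" "a \<in> P" "b \<notin> P"
proof -
  \<comment> \<open>This is the order of the quotient lattice, pulled back to
    representatives.\<close>
  define le where "le x y \<longleftrightarrow> (Lattices.inf x y, x) \<in> R" for x y
  note R_rules = LM_congruenceD[OF R]
  have 1: "le x y" if "x \<le> y" for x y
    using that R_rules(1) by (simp add: le_def inf_absorb1)
  have 2: "le x z" if "le x y" "le y z" for x y z
  proof -
    have xy: "(Lattices.inf x y, x) \<in> R" and yz: "(Lattices.inf y z, y) \<in> R"
      using that by (simp_all add: le_def)
    have "(Lattices.inf x z, Lattices.inf (Lattices.inf x y) z) \<in> R"
      using R_rules(2,5) R_rules(1)[of z] xy by blast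
    moreover have "(Lattices.inf (Lattices.inf x y) z, Lattices.inf x y) \<in> R"
      using R_rules(5)[OF R_rules(1)[of x] yz] by (simp add: inf_assoc)
    ultimately show ?thesis
      unfolding le_def using R_rules(3) xy by blast
  qed
  have 3: "le z (Lattices.inf x y)" if "le z x" "le z y" for x y z
    using R_rules(5)[of "Lattices.inf z x" z "Lattices.inf z y" z] that
    by (simp add: le_def inf_aci)
  have 4: "le (Lattices.sup x y) z" if "le x z" "le y z" for x y z
    using R_rules(4)[of "Lattices.inf x z" x "Lattices.inf y z" y] that
    by (simp add: le_def inf_sup_distrib2)
  have 5: "\<not> le a b"
    using ab by (simp add: le_def)
  have "\<exists>P. prime_filter P \<and> (\<forall>x y. le x y \<longrightarrow> x \<in> P \<longrightarrow> y \<in> P) \<and> a \<in> P \<and> b \<notin> P"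
    by (rule prime_filter_for_preorder; fact 1 2 3 4 5)
  then obtain P where P: "prime_filter P" "\<And>x y. le x y \<Longrightarrow> x \<in> P \<Longrightarrow> y \<in> P" "a \<in> P" "b \<notin> P"
    by blast
  \<comment> \<open>Related elements are below each other in \<open>le\<close>, so closure under
    \<open>le\<close> makes \<open>P\<close> saturated.\<close>
  have "le x y" if "(x, y) \<in> R" for x y
    using R_rules(5)[OF R_rules(1)[of x] R_rules(2)[OF that]] by (simp add: le_def)
  then have "P \<in> saturated_primes R"
    using P(1,2) R_rules(2) unfolding saturated_primes_def prime_filters_def by blast
  then show thesis
    using that P by blast
qed

text \<open>If no saturated prime filter separates \<open>a\<close> from \<open>b\<close>, then
  separation fails in both directions, and \<open>inf a b\<close> is related to \<open>a\<close> and
  to \<open>b\<close>.\<close>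

lemma agreement_saturated_primes:
  assumes R: "LM_congruence \<phi> \<phi>b R"
  shows "agreement (saturated_primes R) = R"
proof -
  have sub: "saturated_primes R \<subseteq> prime_filters"
    by (auto simp: saturated_primes_def)
  have inf: "(Lattices.inf a b, a) \<in> R" if ab: "(a, b) \<in> agreement (saturated_primes R)" for a b
  proof (rule ccontr)
    assume "(Lattices.inf a b, a) \<notin> R"
    then obtain P where "P \<in> saturated_primes R" "a \<in> P" "b \<notin> P"
      by (rule congruence_prime_separation[OF R])
    then show False
      using ab by (simp add: mem_agreement_iff[OF sub])
  qed
  have "(a, b) \<in> R" if ab: "(a, b) \<in> agreement (saturated_primes R)" for a b
  proof -
    have "(b, a) \<in> agreement (saturated_primes R)"
      using ab by (simp add: agreement_def)
    then have "(Lattices.inf a b, a) \<in> R" "(Lattices.inf a b, b) \<in> R"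
      using inf[of a b] inf[of b a] ab by (simp_all add: inf_commute)
    then show ?thesis
      using LM_congruenceD(2,3)[OF R] by blast
  qed
  moreover have "R \<subseteq> agreement (saturated_primes R)"
  proof
    fix p assume "p \<in> R"
    then show "p \<in> agreement (saturated_primes R)"
      using mem_agreement_iff[OF sub, of "fst p" "snd p"] by (auto simp: saturated_primes_def)
  qed
  ultimately show ?thesis by auto
qed

lemma saturated_primes_eq_empty:
  assumes "(Orderings.bot, Orderings.top) \<in> R"
  shows "saturated_primes R = {}"
proof -
  have "P \<notin> saturated_primes R" for P
    using assms prime_filterD(1,2)[of P] by (auto simp: saturated_primes_def prime_filters_def)
  then show ?thesis by blast
qed

lemma saturated_primes_Un: "saturated_primes (R \<union> S) = saturated_primes R \<inter> saturated_primes S"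
  by (auto simp: saturated_primes_def)

text \<open>If \<open>P\<close> separates \<open>(a, b) \<in> R\<close> and \<open>(c, d) \<in> S\<close>, with \<open>b\<close> and \<open>d\<close> outside, then it separates
  \<open>a \<and> c\<close> from \<open>a \<and> c \<and> (b \<or> d)\<close>, and these two elements are related by both \<open>R\<close> and \<open>S\<close>.\<close>

lemma saturated_primes_cover:
  assumes R: "LM_congruence \<phi> \<phi>b R" and S: "LM_congruence \<phi> \<phi>b S" and RS: "R \<inter> S = Id"
  shows "saturated_primes R \<union> saturated_primes S = prime_filters"
proof -
  have unsaturated: "\<exists>a b. (a, b) \<in> T \<and> a \<in> P \<and> b \<notin> P"
    if T: "LM_congruence \<phi> \<phi>b T" and P: "P \<in> prime_filters" "P \<notin> saturated_primes T" for T P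
  proof -
    obtain a b where "(a, b) \<in> T" "(a \<in> P) \<noteq> (b \<in> P)"
      using P by (auto simp: saturated_primes_def)
    then show ?thesis
      using LM_congruenceD(2)[OF T] by blast
  qed
  have "P \<in> saturated_primes R \<or> P \<in> saturated_primes S" if P: "P \<in> prime_filters" for P
  proof (rule ccontr)
    assume "\<not> ?thesis"
    then obtain a b c d where ab: "(a, b) \<in> R" "a \<in> P" "b \<notin> P" and cd: "(c, d) \<in> S" "c \<in> P" "d \<notin> P"
      using unsaturated[OF R P] unsaturated[OF S P] by blast
    let ?x = "Lattices.inf a c"
    let ?y = "Lattices.inf ?x (Lattices.sup b d)"
    have "(Lattices.inf ?x (Lattices.sup a d), ?y) \<in> R"
      by (intro LM_congruenceD(1,4,5)[OF R] ab)
    moreover have "Lattices.inf ?x (Lattices.sup a d) = ?x"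
      by (simp add: inf_absorb1 le_infI1)
    moreover have "(Lattices.inf ?x (Lattices.sup b c), ?y) \<in> S"
      by (intro LM_congruenceD(1,4,5)[OF S] cd)
    moreover have "Lattices.inf ?x (Lattices.sup b c) = ?x"
      by (simp add: inf_absorb1 le_infI2)
    ultimately have "?x = ?y"
      using RS by auto
    moreover have "?x \<in> P" "?y \<notin> P"
      using P ab cd prime_filterD(3,4)[of P] by (auto simp: prime_filters_def)
    ultimately show False by simp
  qed
  then show ?thesis
    by (auto simp: saturated_primes_def)
qed

subsection \<open>The topology\<close>

lemma \<sigma>_lattice_ops:
  shows \<sigma>_inf: "\<sigma> (Lattices.inf a b) = \<sigma> a \<inter> \<sigma> b"
    and \<sigma>_sup: "\<sigma> (Lattices.sup a b) = \<sigma> a \<union> \<sigma> b"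
    and \<sigma>_bot: "\<sigma> Orderings.bot = {}"
    and \<sigma>_top: "\<sigma> Orderings.top = prime_filters"
  by (auto simp: \<sigma>_def prime_filters_def prime_filterD)

text \<open>The differences \<open>\<sigma> a - \<sigma> b\<close> form a base: they include the
  subbasis, by taking \<open>b\<close> as bottom or \<open>a\<close> as top, and are closed under
  binary intersection.\<close>

lemma openin_prime_filter_space_basis:
  assumes "openin prime_filter_space U" "P \<in> U"
  obtains a b where "P \<in> \<sigma> a - \<sigma> b" "\<sigma> a - \<sigma> b \<subseteq> U"
proof -
  have "generate_topology_on (range \<sigma> \<union> range (\<lambda>a. prime_filters - \<sigma> a)) U"
    using assms(1) by (simp add: prime_filter_space_def openin_topology_generated_by)
  then have "\<exists>a b. P \<in> \<sigma> a - \<sigma> b \<and> \<sigma> a - \<sigma> b \<subseteq> U"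
    using assms(2)
  proof (induction arbitrary: P)
    case Empty
    then show ?case by simp
  next
    case (Int U V)
    from Int.prems Int.IH(1)[of P] obtain a b where ab: "P \<in> \<sigma> a - \<sigma> b" "\<sigma> a - \<sigma> b \<subseteq> U"
      by auto
    from Int.prems Int.IH(2)[of P] obtain c d where cd: "P \<in> \<sigma> c - \<sigma> d" "\<sigma> c - \<sigma> d \<subseteq> V"
      by auto
    have "\<sigma> (Lattices.inf a c) - \<sigma> (Lattices.sup b d) = (\<sigma> a - \<sigma> b) \<inter> (\<sigma> c - \<sigma> d)"
      by (auto simp: \<sigma>_inf \<sigma>_sup)
    then show ?case
      using ab cd by (intro exI[of _ "Lattices.inf a c"] exI[of _ "Lattices.sup b d"]) auto
  next
    case (UN K)
    then obtain k where k: "k \<in> K" "P \<in> k" by blast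
    then obtain a b where "P \<in> \<sigma> a - \<sigma> b" "\<sigma> a - \<sigma> b \<subseteq> k"
      using UN.IH by blast
    then show ?case
      using k(1) by (intro exI[of _ a] exI[of _ b]) auto
  next
    case (Basis s)
    then consider a where "s = \<sigma> a - \<sigma> Orderings.bot" | b where "s = \<sigma> Orderings.top - \<sigma> b"
      by (auto simp: \<sigma>_bot \<sigma>_top)
    then show ?case
      using Basis.prems by cases blast+
  qed
  then show thesis
    using that by blast
qed

lemma clopen_\<sigma>: "openin prime_filter_space (\<sigma> a)" "closedin prime_filter_space (\<sigma> a)"
proof -
  show "openin prime_filter_space (\<sigma> a)"
    unfolding prime_filter_space_def by (rule topology_generated_by_Basis) simp
  have "openin prime_filter_space (prime_filters - \<sigma> a)"
    unfolding prime_filter_space_def by (rule topology_generated_by_Basis) simp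
  then show "closedin prime_filter_space (\<sigma> a)"
    unfolding closedin_def topspace_prime_filter_space by (auto simp: \<sigma>_def)
qed

text \<open>Each pair in \<open>R\<close> imposes the clopen condition of lying outside a symmetric
  difference.\<close>

lemma closedin_saturated_primes: "closedin prime_filter_space (saturated_primes R)"
proof -
  have "closedin prime_filter_space (prime_filters - sym_diff (\<sigma> a) (\<sigma> b))" for a b :: 'a
    unfolding topspace_prime_filter_space[symmetric]
    by (intro closedin_diff closedin_topspace openin_Un openin_diff clopen_\<sigma>)
  \<comment> \<open>The factor \<open>prime_filters\<close> matters for empty \<open>R\<close>,
    where the indexed intersection is the whole type.\<close>
  then have "closedin prime_filter_space
      (prime_filters \<inter> (\<Inter>(a, b)\<in>R. prime_filters - sym_diff (\<sigma> a) (\<sigma> b)))"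
    by (cases "R = {}")
      (auto intro!: closedin_Int closedin_INT simp: topspace_prime_filter_space[symmetric])
  moreover have "saturated_primes R = prime_filters \<inter> (\<Inter>(a, b)\<in>R. prime_filters - sym_diff (\<sigma> a) (\<sigma> b))"
    by (auto simp: saturated_primes_def \<sigma>_def)
  ultimately show ?thesis by simp
qed

text \<open>A prime filter outside the closed set \<open>Y\<close> has a basic neighbourhood \<open>\<sigma> a - \<sigma> b\<close> disjoint
  from \<open>Y\<close>, so that \<open>a\<close> and \<open>a \<and> b\<close> agree on \<open>Y\<close>.\<close>

lemma saturated_primes_agreement:
  assumes Y: "closedin prime_filter_space Y"
  shows "saturated_primes (agreement Y) = Y"
proof
  have Y_sub: "Y \<subseteq> prime_filters"
    using closedin_subset[OF Y] by (simp add: topspace_prime_filter_space)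
  then show "Y \<subseteq> saturated_primes (agreement Y)"
    using mem_agreement_iff[OF Y_sub] by (auto simp: saturated_primes_def)
  show "saturated_primes (agreement Y) \<subseteq> Y"
  proof
    fix P assume P: "P \<in> saturated_primes (agreement Y)"
    show "P \<in> Y"
    proof (rule ccontr)
      assume "P \<notin> Y"
      moreover have "openin prime_filter_space (prime_filters - Y)"
        using Y by (simp add: closedin_def topspace_prime_filter_space)
      ultimately obtain a b where ab: "P \<in> \<sigma> a - \<sigma> b" "\<sigma> a - \<sigma> b \<subseteq> prime_filters - Y"
        using P openin_prime_filter_space_basis[of "prime_filters - Y" P]
        by (auto simp: saturated_primes_def)
      have "(a, Lattices.inf a b) \<in> agreement Y"
        using ab(2) by (auto simp: agreement_def \<sigma>_inf)
      then have "a \<in> P \<longleftrightarrow> Lattices.inf a b \<in> P"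
        using P by (auto simp: saturated_primes_def)
      then show False
        using ab(1) \<sigma>_inf[of a b] by (auto simp: \<sigma>_def)
    qed
  qed
qed

text \<open>A closed set is recovered from its agreement, and a larger relation saturates fewer
  prime filters.\<close>

lemma agreement_subset_iff:
  assumes "closedin prime_filter_space Y" "closedin prime_filter_space Z"
  shows "agreement Y \<subseteq> agreement Z \<longleftrightarrow> Z \<subseteq> Y"
proof
  assume "agreement Y \<subseteq> agreement Z"
  then have "saturated_primes (agreement Z) \<subseteq> saturated_primes (agreement Y)"
    unfolding saturated_primes_def by blast
  then show "Z \<subseteq> Y"
    using assms by (simp add: saturated_primes_agreement)
qed (auto simp: agreement_def)

subsection \<open>Complementary congruences\<close>

text \<open>Supplies the lattice of congruences: the empty family gives the top, a pair gives the
  meet, and all congruences above \<open>R \<union> S\<close> give the join.\<close>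

lemma LM_congruence_Inter:
  assumes "\<And>T. T \<in> \<T> \<Longrightarrow> LM_congruence \<phi> \<phi>b T"
  shows "LM_congruence \<phi> \<phi>b (\<Inter>\<T>)"
proof -
  note rules = LM_congruenceD[OF assms]
  have "trans (\<Inter>\<T>)"
  proof (intro transI InterI)
    fix x y z T
    assume "(x, y) \<in> \<Inter>\<T>" "(y, z) \<in> \<Inter>\<T>" "T \<in> \<T>"
    then show "(x, z) \<in> T"
      using rules(3)[of T x y z] by simp
  qed
  then have "equiv UNIV (\<Inter>\<T>)"
    by (auto intro!: equivI refl_onI symI intro: rules(1,2))
  then show ?thesis
    by (auto simp: LM_congruence_def intro: rules(4-7))
qed

lemma LM_congruence_UNIV: "LM_congruence \<phi> \<phi>b UNIV"
  using LM_congruence_Inter[of "{}" \<phi> \<phi>b] by simp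

lemma LM_congruence_Id: "LM_congruence \<phi> \<phi>b Id"
  by (auto simp: LM_congruence_def equiv_def refl_on_def sym_def trans_def)

text \<open>The join is the least congruence containing \<open>R \<union> S\<close>; it is the top
  exactly when no proper congruence contains both.\<close>

lemma complement_in_Con_LM_iff:
  "complement_in (Con_LM \<phi> \<phi>b) R S \<longleftrightarrow> LM_congruence \<phi> \<phi>b R \<and> LM_congruence \<phi> \<phi>b S \<and>
    R \<inter> S = Id \<and> (\<forall>T. LM_congruence \<phi> \<phi>b T \<longrightarrow> R \<union> S \<subseteq> T \<longrightarrow> T = UNIV)"
proof (cases "LM_congruence \<phi> \<phi>b R \<and> LM_congruence \<phi> \<phi>b S")
  case True
  let ?L = "Con_LM \<phi> \<phi>b"
  let ?J = "\<Inter>{T. LM_congruence \<phi> \<phi>b T \<and> R \<union> S \<subseteq> T}"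
  interpret partial_order ?L
    unfolding Con_LM_def by (rule partial_order_inclusion_order)
  have car: "carrier ?L = {R. LM_congruence \<phi> \<phi>b R}" and le: "le ?L = (\<subseteq>)"
    by (simp_all add: Con_LM_def inclusion_order_def)
  have RS: "R \<in> carrier ?L" "S \<in> carrier ?L"
    using True by (simp_all add: car)
  have "LM_congruence \<phi> \<phi>b ?J"
    by (rule LM_congruence_Inter) simp
  then have "R \<squnion>\<^bsub>?L\<^esub> S = ?J"
    using RS by (intro join_eqI partial_order_axioms) (auto simp: least_Upper_pair_iff car le)
  moreover have "LM_congruence \<phi> \<phi>b (R \<inter> S)"
    using LM_congruence_Inter[of "{R, S}" \<phi> \<phi>b] True by auto
  then have "R \<sqinter>\<^bsub>?L\<^esub> S = R \<inter> S"
    using RS by (intro meet_eqI partial_order_axioms) (auto simp: greatest_Lower_pair_iff car le)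
  moreover have greatest: "greatest ?L UNIV (carrier ?L)"
    by (simp add: greatest_def car le LM_congruence_UNIV)
  then have "\<top>\<^bsub>?L\<^esub> = UNIV"
    unfolding top_def by (rule some_equality) (rule greatest_unique[OF _ greatest])
  moreover have least: "least ?L Id (carrier ?L)"
    by (auto simp: least_def car le LM_congruence_Id intro: LM_congruenceD(1))
  then have "\<bottom>\<^bsub>?L\<^esub> = Id"
    unfolding bottom_def by (rule some_equality) (rule least_unique[OF _ least])
  ultimately show ?thesis
    using True by (auto simp: complement_in_def car)
next
  case False
  then show ?thesis
    by (auto simp: complement_in_def Con_LM_def inclusion_order_def)
qed

section \<open>Stability and modality under inverse images of the \<open>\<phi> i\<close>\<close>

lemma modal_imp_stable:
  assumes "modal \<phi> Y" "i > Orderings.bot" "P \<in> Y"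
  shows "\<phi> i -` P \<in> Y"
  using assms by (auto simp: modal_def)

context LM_algebra
begin

lemma prime_filter_vimage:
  assumes i: "i > Orderings.bot" and P: "P \<in> prime_filters"
  shows "\<phi> i -` P \<in> prime_filters"
proof -
  note P_rules = prime_filterD[OF P[unfolded prime_filters_def mem_Collect_eq]]
  have "y \<in> \<phi> i -` P" if "x \<in> \<phi> i -` P" "x \<le> y" for x y
    using that phi_inf[OF i, of x y] P_rules(3)[of "\<phi> i x" "\<phi> i y"] by (simp add: inf_absorb1)
  moreover have "Orderings.top \<in> \<phi> i -` P" "Orderings.bot \<notin> \<phi> i -` P"
    using P_rules(1,2) phi_top[OF i] phi_bot[OF i] by auto
  then have "\<phi> i -` P \<noteq> {}" "\<phi> i -` P \<noteq> UNIV"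
    by blast+
  ultimately show ?thesis
    using P_rules(3,4) phi_inf[OF i] phi_sup[OF i]
    unfolding prime_filters_def prime_filter_def by auto
qed

lemma modal_Diff:
  assumes "modal \<phi> Y"
  shows "modal \<phi> (prime_filters - Y)"
proof -
  have "\<phi> i -` P \<in> Y \<longleftrightarrow> P \<in> Y" if "i > Orderings.bot" "P \<in> prime_filters" for i P
    using assms that unfolding modal_def by blast
  then show ?thesis
    using prime_filter_vimage by (auto simp: modal_def)
qed

text \<open>The elements \<open>\<phi> i a\<close> and \<open>\<phi>b i a\<close> are lattice
  complements, and a prime filter contains exactly one of two complements. Compatibility with
  \<open>\<phi>b\<close> thus follows from compatibility with \<open>\<phi>\<close>.\<close>

lemma phib_mem_iff:
  assumes i: "i > Orderings.bot" and P: "P \<in> prime_filters"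
  shows "\<phi>b i a \<in> P \<longleftrightarrow> \<phi> i a \<notin> P"
proof -
  note P_rules = prime_filterD[OF P[unfolded prime_filters_def mem_Collect_eq]]
  show ?thesis
    using P_rules(3,4)[of "\<phi> i a" "\<phi>b i a"] P_rules(1,2)
    by (auto simp: phi_sup_compl[OF i] phi_inf_compl[OF i])
qed

text \<open>Whether \<open>\<phi> i a\<close> lies in \<open>P\<close> is decided by whether
  \<open>a\<close> lies in the inverse image of \<open>P\<close>, which is again a member of
  \<open>Y\<close>.\<close>

lemma LM_congruence_agreement:
  assumes Y: "Y \<subseteq> prime_filters"
    and stable: "\<And>i P. i > Orderings.bot \<Longrightarrow> P \<in> Y \<Longrightarrow> \<phi> i -` P \<in> Y"
  shows "LM_congruence \<phi> \<phi>b (agreement Y)"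
proof -
  have "equiv UNIV (agreement Y)"
    by (intro equivI refl_onI symI transI) (simp_all add: agreement_def)
  moreover have "(\<phi> i a, \<phi> i b) \<in> agreement Y" "(\<phi>b i a, \<phi>b i b) \<in> agreement Y"
    if i: "i > Orderings.bot" and ab: "(a, b) \<in> agreement Y" for i a b
  proof -
    have *: "\<phi> i a \<in> P \<longleftrightarrow> \<phi> i b \<in> P" if "P \<in> Y" for P
    proof -
      have "a \<in> \<phi> i -` P \<longleftrightarrow> b \<in> \<phi> i -` P"
        using ab stable[OF i that] unfolding mem_agreement_iff[OF Y] by (rule bspec)
      then show ?thesis by simp
    qed
    then show "(\<phi> i a, \<phi> i b) \<in> agreement Y"
      unfolding mem_agreement_iff[OF Y] by blast
    show "(\<phi>b i a, \<phi>b i b) \<in> agreement Y"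
      unfolding mem_agreement_iff[OF Y]
    proof
      fix P assume P: "P \<in> Y"
      then have "P \<in> prime_filters" using Y by blast
      then show "\<phi>b i a \<in> P \<longleftrightarrow> \<phi>b i b \<in> P"
        using *[OF P] by (simp add: phib_mem_iff[OF i])
    qed
  qed
  moreover have "(Lattices.sup a c, Lattices.sup b d) \<in> agreement Y"
    "(Lattices.inf a c, Lattices.inf b d) \<in> agreement Y"
    if "(a, b) \<in> agreement Y" "(c, d) \<in> agreement Y" for a b c d
  proof -
    have ab: "\<sigma> a \<inter> Y = \<sigma> b \<inter> Y" and cd: "\<sigma> c \<inter> Y = \<sigma> d \<inter> Y"
      using that by (simp_all add: agreement_def)
    have "(\<sigma> a \<union> \<sigma> c) \<inter> Y = (\<sigma> b \<union> \<sigma> d) \<inter> Y"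
      using ab cd by (simp only: Int_Un_distrib2)
    then show "(Lattices.sup a c, Lattices.sup b d) \<in> agreement Y"
      by (simp add: agreement_def \<sigma>_sup)
    have "\<sigma> a \<inter> \<sigma> c \<inter> Y = \<sigma> b \<inter> \<sigma> d \<inter> Y"
      using ab cd by blast
    then show "(Lattices.inf a c, Lattices.inf b d) \<in> agreement Y"
      by (simp add: agreement_def \<sigma>_inf)
  qed
  ultimately show ?thesis
    unfolding LM_congruence_def by blast
qed

lemma saturated_primes_stable:
  assumes R: "LM_congruence \<phi> \<phi>b R" and "i > Orderings.bot" "P \<in> saturated_primes R"
  shows "\<phi> i -` P \<in> saturated_primes R"
proof -
  have P: "P \<in> prime_filters" "\<And>a b. (a, b) \<in> R \<Longrightarrow> a \<in> P \<longleftrightarrow> b \<in> P"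
    using assms(3) by (auto simp: saturated_primes_def)
  have "\<phi> i a \<in> P \<longleftrightarrow> \<phi> i b \<in> P" if "(a, b) \<in> R" for a b
    using P(2) LM_congruenceD(6)[OF R assms(2) that] by blast
  then show ?thesis
    using prime_filter_vimage[OF assms(2) P(1)] by (auto simp: saturated_primes_def)
qed

text \<open>Stability of the first set gives one direction of modality. For the other, a prime
  filter outside it lies in the second set, whose stability keeps the inverse image there and hence
  outside the first.\<close>

lemma modal_saturated_primes:
  assumes R: "LM_congruence \<phi> \<phi>b R" and S: "LM_congruence \<phi> \<phi>b S"
    and cover: "saturated_primes R \<union> saturated_primes S = prime_filters"
    and disj: "saturated_primes R \<inter> saturated_primes S = {}"
  shows "modal \<phi> (saturated_primes R)"
proof -
  have "\<phi> i -` P \<in> saturated_primes R \<longleftrightarrow> P \<in> saturated_primes R"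
    if "i > Orderings.bot" "P \<in> prime_filters" for i P
    using that cover disj saturated_primes_stable[OF R that(1), of P]
      saturated_primes_stable[OF S that(1), of P] by blast
  then show ?thesis
    using cover by (auto simp: modal_def)
qed

section \<open>Clopen modal sets and complemented congruences\<close>

lemma agreement_is_complemented:
  assumes Y: "closedin prime_filter_space Y" "openin prime_filter_space Y" "modal \<phi> Y"
  shows "complement_in (Con_LM \<phi> \<phi>b) (agreement Y) (agreement (prime_filters - Y))"
proof -
  let ?Z = "prime_filters - Y"
  have YZ: "Y \<subseteq> prime_filters" "?Z \<subseteq> prime_filters"
    using Y(3) by (auto simp: modal_def)
  have Z: "closedin prime_filter_space ?Z"
    using Y(2) by (metis closedin_diff closedin_topspace topspace_prime_filter_space)
  have cong: "LM_congruence \<phi> \<phi>b (agreement Y)" "LM_congruence \<phi> \<phi>b (agreement ?Z)"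
    using YZ Y(3) modal_Diff modal_imp_stable by (metis LM_congruence_agreement)+
  \<comment> \<open>Every prime filter is saturated under the identity, so recovering
    \<open>Id\<close> from its saturated primes says that prime filters separate elements.\<close>
  have "prime_filters = saturated_primes Id"
    by (auto simp: saturated_primes_def)
  then have "agreement prime_filters = (Id :: 'a rel)"
    using agreement_saturated_primes[OF LM_congruence_Id] by metis
  moreover have "agreement Y \<inter> agreement ?Z = agreement prime_filters"
    using YZ by (auto simp: agreement_def \<sigma>_def)
  moreover have "T = UNIV"
    if T: "LM_congruence \<phi> \<phi>b T" "agreement Y \<union> agreement ?Z \<subseteq> T" for T
  proof -
    \<comment> \<open>A prime filter saturated under \<open>T\<close> would lie in both
      \<open>Y\<close> and its complement; with none left, \<open>T\<close> is agreement on the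
      empty set.\<close>
    have "saturated_primes T \<subseteq> saturated_primes (agreement Y \<union> agreement ?Z)"
      using T(2) unfolding saturated_primes_def by blast
    also have "\<dots> = {}"
      using saturated_primes_agreement[OF Y(1)] saturated_primes_agreement[OF Z]
      by (auto simp: saturated_primes_Un)
    finally have "agreement (saturated_primes T) = UNIV"
      by (auto simp: agreement_def)
    then show ?thesis
      using agreement_saturated_primes[OF T(1)] by simp
  qed
  ultimately show ?thesis
    using cong by (simp add: complement_in_Con_LM_iff)
qed

lemma complemented_saturated_primes:
  assumes "complement_in (Con_LM \<phi> \<phi>b) R S"
  shows "openin prime_filter_space (saturated_primes R)" "modal \<phi> (saturated_primes R)"
proof -
  let ?Y = "saturated_primes R" and ?Z = "saturated_primes S"
  have R: "LM_congruence \<phi> \<phi>b R" and S: "LM_congruence \<phi> \<phi>b S" and RS: "R \<inter> S = Id"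
    and top: "\<And>T. LM_congruence \<phi> \<phi>b T \<Longrightarrow> R \<union> S \<subseteq> T \<Longrightarrow> T = UNIV"
    using assms by (simp_all add: complement_in_Con_LM_iff)
  have cover: "?Y \<union> ?Z = prime_filters"
    by (rule saturated_primes_cover[OF R S RS])
  \<comment> \<open>An intersection of stable sets is stable, so agreement on it is a congruence
    above both \<open>R\<close> and \<open>S\<close>, to which \<open>top\<close> applies.\<close>
  have "LM_congruence \<phi> \<phi>b (agreement (?Y \<inter> ?Z))"
    using saturated_primes_stable[OF R] saturated_primes_stable[OF S]
    by (intro LM_congruence_agreement) (auto simp: saturated_primes_def)
  moreover have "agreement ?Y \<union> agreement ?Z \<subseteq> agreement (?Y \<inter> ?Z)"
    by (auto simp: agreement_def)
  then have "R \<union> S \<subseteq> agreement (?Y \<inter> ?Z)"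
    by (simp only: agreement_saturated_primes[OF R] agreement_saturated_primes[OF S])
  ultimately have "agreement (?Y \<inter> ?Z) = UNIV"
    by (rule top)
  \<comment> \<open>Closedness lets the intersection be recovered from its agreement, which is
    \<open>UNIV\<close> and relates bottom to top, so saturates nothing.\<close>
  moreover have "closedin prime_filter_space (?Y \<inter> ?Z)"
    by (intro closedin_Int closedin_saturated_primes)
  ultimately have disj: "?Y \<inter> ?Z = {}"
    using saturated_primes_agreement saturated_primes_eq_empty by (metis UNIV_I)
  show "modal \<phi> ?Y"
    by (rule modal_saturated_primes[OF R S cover disj])
  have "?Y = topspace prime_filter_space - ?Z"
    using cover disj by (auto simp: topspace_prime_filter_space)
  then show "openin prime_filter_space ?Y"
    using closedin_saturated_primes by (metis openin_closedin_eq openin_diff openin_topspace)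
qed

section \<open>The two lattice isomorphisms\<close>

lemma bij_betw_agreement:
  "bij_betw agreement (carrier (CO_M \<phi>)) (carrier (Con_bLM \<phi> \<phi>b))"
proof (rule bij_betw_byWitness[where f' = saturated_primes])
  show "\<forall>Y\<in>carrier (CO_M \<phi>). saturated_primes (agreement Y) = Y"
    by (simp add: CO_M_def inclusion_order_def saturated_primes_agreement)
  show "\<forall>R\<in>carrier (Con_bLM \<phi> \<phi>b). agreement (saturated_primes R) = R"
    using agreement_saturated_primes
    by (fastforce simp: Con_bLM_def inclusion_order_def complement_in_Con_LM_iff)
  show "agreement ` carrier (CO_M \<phi>) \<subseteq> carrier (Con_bLM \<phi> \<phi>b)"
    using agreement_is_complemented by (fastforce simp: CO_M_def Con_bLM_def inclusion_order_def)
  show "saturated_primes ` carrier (Con_bLM \<phi> \<phi>b) \<subseteq> carrier (CO_M \<phi>)"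
    using complemented_saturated_primes closedin_saturated_primes
    by (fastforce simp: CO_M_def Con_bLM_def inclusion_order_def)
qed

lemma bij_betw_Diff_CO_M:
  "bij_betw (\<lambda>Y. prime_filters - Y) (carrier (CO_M \<phi>)) (carrier (CO_M \<phi>))"
proof -
  have "prime_filters - Y \<in> carrier (CO_M \<phi>)" "prime_filters - (prime_filters - Y) = Y"
    if "Y \<in> carrier (CO_M \<phi>)" for Y
  proof -
    have Y: "closedin prime_filter_space Y" "openin prime_filter_space Y" "modal \<phi> Y"
      using that by (simp_all add: CO_M_def inclusion_order_def)
    then show "prime_filters - Y \<in> carrier (CO_M \<phi>)"
      using modal_Diff by (simp add: CO_M_def inclusion_order_def closedin_diff openin_diff
          topspace_prime_filter_space[symmetric])
    show "prime_filters - (prime_filters - Y) = Y"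
      using Y(3) by (auto simp: modal_def)
  qed
  then show ?thesis
    by (intro bij_betw_byWitness[where f' = "\<lambda>Y. prime_filters - Y"]) auto
qed

lemma lattice_CO_M: "lattice (CO_M \<phi>)"
  unfolding CO_M_def
proof (rule lattice_inclusion_orderI)
  show "x \<union> y \<in> {Y. closedin prime_filter_space Y \<and> openin prime_filter_space Y \<and> modal \<phi> Y}"
    if "x \<in> {Y. closedin prime_filter_space Y \<and> openin prime_filter_space Y \<and> modal \<phi> Y}"
      "y \<in> {Y. closedin prime_filter_space Y \<and> openin prime_filter_space Y \<and> modal \<phi> Y}" for x y
    using that by (auto simp: modal_def)
  show "x \<inter> y \<in> {Y. closedin prime_filter_space Y \<and> openin prime_filter_space Y \<and> modal \<phi> Y}"
    if "x \<in> {Y. closedin prime_filter_space Y \<and> openin prime_filter_space Y \<and> modal \<phi> Y}"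
      "y \<in> {Y. closedin prime_filter_space Y \<and> openin prime_filter_space Y \<and> modal \<phi> Y}" for x y
    using that by (auto simp: modal_def)
qed

lemma lattice_iso_agreement:
  "lattice_iso (CO_M \<phi>) (inv_gorder (Con_bLM \<phi> \<phi>b)) agreement"
proof (rule lattice_iso_of_order_iso)
  show "partial_order (inv_gorder (Con_bLM \<phi> \<phi>b))"
    unfolding Con_bLM_def by (intro partial_order_inv_gorder partial_order_inclusion_order)
  show "bij_betw agreement (carrier (CO_M \<phi>)) (carrier (inv_gorder (Con_bLM \<phi> \<phi>b)))"
    using bij_betw_agreement by simp
qed (simp_all add: lattice_CO_M, simp add: CO_M_def Con_bLM_def inclusion_order_def agreement_subset_iff)

text \<open>Complementation permutes the clopen modal sets and reverses inclusion, which cancels the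
  reversal by \<open>agreement\<close>.\<close>

lemma lattice_iso_agreement_Diff:
  "lattice_iso (CO_M \<phi>) (Con_bLM \<phi> \<phi>b) (\<lambda>G. agreement (prime_filters - G))"
proof (rule lattice_iso_of_order_iso)
  show "partial_order (Con_bLM \<phi> \<phi>b)"
    unfolding Con_bLM_def by (rule partial_order_inclusion_order)
  show "bij_betw (\<lambda>G. agreement (prime_filters - G)) (carrier (CO_M \<phi>)) (carrier (Con_bLM \<phi> \<phi>b))"
    using bij_betw_trans[OF bij_betw_Diff_CO_M bij_betw_agreement] by (simp add: o_def)
  fix x y
  assume "x \<in> carrier (CO_M \<phi>)" "y \<in> carrier (CO_M \<phi>)"
  then have "openin prime_filter_space x" "openin prime_filter_space y"
    "x \<subseteq> prime_filters" "y \<subseteq> prime_filters"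
    by (simp_all add: CO_M_def inclusion_order_def modal_def)
  then have "agreement (prime_filters - x) \<subseteq> agreement (prime_filters - y) \<longleftrightarrow> x \<subseteq> y"
    by (subst agreement_subset_iff)
      (auto simp: closedin_diff topspace_prime_filter_space[symmetric])
  then show "agreement (prime_filters - x) \<sqsubseteq>\<^bsub>Con_bLM \<phi> \<phi>b\<^esub> agreement (prime_filters - y) \<longleftrightarrow>
      x \<sqsubseteq>\<^bsub>CO_M \<phi>\<^esub> y"
    by (simp add: CO_M_def Con_bLM_def inclusion_order_def)
qed (rule lattice_CO_M)

end

theorem theorem4p10:
  fixes \<phi> \<phi>b :: "'j::{linorder,order_bot} \<Rightarrow> 'a::{distrib_lattice,bounded_lattice} \<Rightarrow> 'a"
  assumes "LM_algebra \<phi> \<phi>b"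
  shows "lattice_iso (CO_M \<phi>) (Con_bLM \<phi> \<phi>b)
           (\<lambda>G. {(a, b). sym_diff (\<sigma> b) (\<sigma> a) \<subseteq> G})
       \<and> lattice_iso (CO_M \<phi>) (inv_gorder (Con_bLM \<phi> \<phi>b))
           (\<lambda>Y. {(a, b). \<sigma> a \<inter> Y = \<sigma> b \<inter> Y})"
proof -
  interpret LM_algebra \<phi> \<phi>b by fact
  \<comment> \<open>Agreeing outside \<open>G\<close> means differing only inside \<open>G\<close>,
    since \<open>\<sigma> a\<close> and \<open>\<sigma> b\<close> consist of prime filters.\<close>
  have "agreement (prime_filters - G) = {(a, b). sym_diff (\<sigma> b) (\<sigma> a) \<subseteq> G}"
    for G :: "'a set set"
    by (auto simp: agreement_def \<sigma>_def)
  then show ?thesis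
    using lattice_iso_agreement_Diff lattice_iso_agreement unfolding agreement_def by simp
qed

end
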